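(* Let $\mu\in\mathcal{P}(\Theta)$ and $\Phi_1,\Phi_2\in L^2_\mu(\Theta,\mathbb{R})$ be such that $\mu_{\Phi_i}\in\mathcal{P}(\Theta)$ for $i=1,2$. (i) If in addition $\operatorname{ess\,inf}_\mu\Phi_i\geq 0$ for $i=1,2$, then $$d_{\mathrm{H}}(\mu_{\Phi_1},\mu_{\Phi_2})\leq\frac12\,\frac{1}{Z_{\Phi_1,\mu}^{1/2}\wedge Z_{\Phi_2,\mu}^{1/2}}\left\Vert\Phi_1-\Phi_2+\log\frac{Z_{\Phi_1,\mu}}{Z_{\Phi_2,\mu}}\right\Vert_{L^2_\mu}.$$ (ii) If in addition $\Phi_i\in L^\infty_\mu(\Theta,\mathbb{R}_{\geq 0})$ for $i=1,2$, then $$d_{\mathrm{H}}(\mu_{\Phi_1},\mu_{\Phi_2})\geq\frac12\left(\frac{\exp(-\frac12\Vert\Phi_1\Vert_{L^\infty_\mu})}{Z_{\Phi_1,\mu}^{1/2}}\wedge\frac{\exp(-\frac12\Vert\Phi_2\Vert_{L^\infty_\mu})}{Z_{\Phi_2,\mu}^{1/2}}\right)\left\Vert\Phi_1-\Phi_2+\log\frac{Z_{\Phi_1,\mu}}{Z_{\Phi_2,\mu}}\right\Vert_{L^2_\mu}.$$ For both the upper bound in (i) and the lower bound in (ii), equality holds if and only if $\Phi_1-\Phi_2$ is $\mu$-a.s. constant.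
   Context: $(\Theta,\Sigma)$ is a measurable space and $\mathcal{P}(\Theta)$ is the set of probability measures on it. For $I\subset\mathbb{R}$ and $p\in[1,\infty]$, $L^p_\mu(\Theta,I)$ is the set of $\Sigma$-measurable functions $\Theta\to I$ with finite $L^p(\mu)$-norm. For measurable $\Phi:\Theta\to\mathbb{R}$ and $\mu\in\mathcal{P}(\Theta)$: $Z_{\Phi,\mu}:=\int e^{-\Phi}\,\mathrm{d}\mu$; if $0<Z_{\Phi,\mu}<\infty$, then $\mu_\Phi$ is the measure with $\frac{\mathrm{d}\mu_\Phi}{\mathrm{d}\mu}=e^{-\Phi}/Z_{\Phi,\mu}$. The requirement $\mu_\Phi\in\mathcal{P}(\Theta)$ means $0<Z_{\Phi,\mu}<\infty$. The Hellinger metric is $d_{\mathrm{H}}(\mu_1,\mu_2):=\left(\int\left(\sqrt{\frac{\mathrm{d}\mu_1}{\mathrm{d}\nu}}-\sqrt{\frac{\mathrm{d}\mu_2}{\mathrm{d}\nu}}\right)^2\mathrm{d}\nu\right)^{1/2}$ for any $\nu\in\mathcal{P}(\Theta)$ with $\mu_1,\mu_2\ll\nu$ (the value does not depend on $\nu$). $a\wedge b:=\min\{a,b\}$. *)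

theory Defs
  imports "HOL-Probability.Probability"
begin

section \<open>Lebesgue spaces and essential bounds\<close>

text \<open>
  The \<open>L\<^sup>p\<close> norm for an exponent \<open>1 \<le> p \<le> \<infinity>\<close>, with value \<open>\<infinity>\<close> where the norm is infinite.
  The case distinction on the integral is needed because \<^const>\<open>enn2real\<close> maps \<open>\<infinity>\<close> to \<open>0\<close>.
\<close>

definition eLp_norm :: "ennreal \<Rightarrow> 'a measure \<Rightarrow> ('a \<Rightarrow> real) \<Rightarrow> ereal" where
  "eLp_norm p \<mu> f =
     (if p = \<infinity> then esssup \<mu> (\<lambda>x. ereal \<bar>f x\<bar>)
      else if (\<integral>\<^sup>+x. ennreal (\<bar>f x\<bar> powr enn2real p) \<partial>\<mu>) < \<infinity>
      then ereal (enn2real (\<integral>\<^sup>+x. ennreal (\<bar>f x\<bar> powr enn2real p) \<partial>\<mu>) powr (1 / enn2real p))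
      else \<infinity>)"

text \<open>The norm as a real number; meaningful only for functions whose norm is finite.\<close>

definition Lp_norm :: "ennreal \<Rightarrow> 'a measure \<Rightarrow> ('a \<Rightarrow> real) \<Rightarrow> real" where
  "Lp_norm p \<mu> f = real_of_ereal (eLp_norm p \<mu> f)"

text \<open>Functions, not equivalence classes: membership in \<open>I\<close> is required at every point.\<close>

definition Lp_space :: "ennreal \<Rightarrow> 'a measure \<Rightarrow> real set \<Rightarrow> ('a \<Rightarrow> real) set" where
  "Lp_space p \<mu> I = {f \<in> borel_measurable \<mu>. f \<in> space \<mu> \<rightarrow> I \<and> eLp_norm p \<mu> f < \<infinity>}"

definition essinf :: "'a measure \<Rightarrow> ('a \<Rightarrow> real) \<Rightarrow> ereal" where
  "essinf \<mu> f = Sup {z. AE x in \<mu>. z \<le> ereal (f x)}"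


section \<open>Reweighted measures\<close>

definition normalization_const :: "'a measure \<Rightarrow> ('a \<Rightarrow> real) \<Rightarrow> ennreal" where
  "normalization_const \<mu> \<Phi> = (\<integral>\<^sup>+x. ennreal (exp (- \<Phi> x)) \<partial>\<mu>)"

definition reweighted :: "'a measure \<Rightarrow> ('a \<Rightarrow> real) \<Rightarrow> 'a measure" where
  "reweighted \<mu> \<Phi> = density \<mu> (\<lambda>x. ennreal (exp (- \<Phi> x)) / normalization_const \<mu> \<Phi>)"

lemma reweighted_in_prob_algebra_iff:
  assumes "\<mu> \<in> space (prob_algebra \<Theta>)" and [measurable]: "\<Phi> \<in> borel_measurable \<mu>"
  shows "reweighted \<mu> \<Phi> \<in> space (prob_algebra \<Theta>) \<longleftrightarrow>
           0 < normalization_const \<mu> \<Phi> \<and> normalization_const \<mu> \<Phi> < \<infinity>"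
proof -
  have sets: "sets (reweighted \<mu> \<Phi>) = sets \<Theta>"
    using assms(1) by (simp add: reweighted_def space_prob_algebra)
  have "emeasure (reweighted \<mu> \<Phi>) (space (reweighted \<mu> \<Phi>))
        = (\<integral>\<^sup>+x. ennreal (exp (- \<Phi> x)) / normalization_const \<mu> \<Phi> \<partial>\<mu>)"
    by (simp add: reweighted_def emeasure_density cong: nn_integral_cong)
  also have "\<dots> = normalization_const \<mu> \<Phi> / normalization_const \<mu> \<Phi>"
    by (subst nn_integral_divide) (simp_all add: normalization_const_def)
  also have "\<dots> = 1 \<longleftrightarrow> 0 < normalization_const \<mu> \<Phi> \<and> normalization_const \<mu> \<Phi> < \<infinity>"
    by (cases "normalization_const \<mu> \<Phi> = 0"; cases "normalization_const \<mu> \<Phi> = top")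
       (auto simp: ennreal_divide_self less_top zero_less_iff_neq_zero)
  finally show ?thesis
    using sets by (auto simp: space_prob_algebra intro: prob_spaceI dest: prob_space.emeasure_space_1)
qed


section \<open>The Hellinger metric\<close>

definition hellinger_wrt :: "'a measure \<Rightarrow> 'a measure \<Rightarrow> 'a measure \<Rightarrow> real" where
  "hellinger_wrt \<nu> \<mu>\<^sub>1 \<mu>\<^sub>2 =
     sqrt (LINT x|\<nu>. (sqrt (enn2real (RN_deriv \<nu> \<mu>\<^sub>1 x)) - sqrt (enn2real (RN_deriv \<nu> \<mu>\<^sub>2 x)))\<^sup>2)"

definition dominating :: "'a measure \<Rightarrow> 'a measure \<Rightarrow> 'a measure \<Rightarrow> bool" where
  "dominating \<nu> \<mu>\<^sub>1 \<mu>\<^sub>2 \<longleftrightarrow> \<nu> \<in> space (prob_algebra \<mu>\<^sub>1) \<and>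
     absolutely_continuous \<nu> \<mu>\<^sub>1 \<and> absolutely_continuous \<nu> \<mu>\<^sub>2"

text \<open>
  The choice of \<open>\<nu>\<close> is immaterial, and such a \<open>\<nu>\<close> always exists; see
  \<open>hellinger_eq_hellinger_wrt\<close> and \<open>dominating_exists\<close> below.
\<close>

definition hellinger :: "'a measure \<Rightarrow> 'a measure \<Rightarrow> real" where
  "hellinger \<mu>\<^sub>1 \<mu>\<^sub>2 = hellinger_wrt (SOME \<nu>. dominating \<nu> \<mu>\<^sub>1 \<mu>\<^sub>2) \<mu>\<^sub>1 \<mu>\<^sub>2"

lemma dominating_exists:
  assumes "\<mu>\<^sub>1 \<in> space (prob_algebra \<Theta>)" "\<mu>\<^sub>2 \<in> space (prob_algebra \<Theta>)"
  shows "\<exists>\<nu>. dominating \<nu> \<mu>\<^sub>1 \<mu>\<^sub>2"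
proof -
  interpret m1: prob_space \<mu>\<^sub>1 using assms by (simp add: space_prob_algebra)
  interpret m2: prob_space \<mu>\<^sub>2 using assms by (simp add: space_prob_algebra)
  have s: "sets \<mu>\<^sub>2 = sets \<mu>\<^sub>1" using assms by (simp add: space_prob_algebra)
  then have sp: "space \<mu>\<^sub>2 = space \<mu>\<^sub>1" by (rule sets_eq_imp_space_eq)
  define f where "f A = (emeasure \<mu>\<^sub>1 A + emeasure \<mu>\<^sub>2 A) / 2" for A
  define \<nu> where "\<nu> = measure_of (space \<mu>\<^sub>1) (sets \<mu>\<^sub>1) f"
  have sets: "sets \<nu> = sets \<mu>\<^sub>1" by (simp add: \<nu>_def)
  have em: "emeasure \<nu> A = f A" if "A \<in> sets \<mu>\<^sub>1" for A
    unfolding \<nu>_def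
  proof (rule emeasure_measure_of_sigma)
    show "sigma_algebra (space \<mu>\<^sub>1) (sets \<mu>\<^sub>1)" by (rule sets.sigma_algebra_axioms)
    show "positive (sets \<mu>\<^sub>1) f" by (simp add: positive_def f_def)
    show "countably_additive (sets \<mu>\<^sub>1) f"
    proof (rule countably_additiveI)
      fix B :: "nat \<Rightarrow> 'a set"
      assume B: "range B \<subseteq> sets \<mu>\<^sub>1" "disjoint_family B"
      have "(\<Sum>i. f (B i)) = ((\<Sum>i. emeasure \<mu>\<^sub>1 (B i)) + (\<Sum>i. emeasure \<mu>\<^sub>2 (B i))) / 2"
        by (simp add: f_def suminf_add[symmetric] divide_ennreal_def)
      also have "\<dots> = f (\<Union>i. B i)"
        using B s by (simp add: f_def suminf_emeasure)
      finally show "(\<Sum>i. f (B i)) = f (\<Union>i. B i)" .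
    qed
    show "A \<in> sets \<mu>\<^sub>1" by fact
  qed
  have "emeasure \<nu> (space \<nu>) = 1"
    using em[of "space \<mu>\<^sub>1"] sets_eq_imp_space_eq[OF sets] sp m2.emeasure_space_1
    by (simp add: f_def m1.emeasure_space_1 ennreal_divide_self)
  then have "prob_space \<nu>" by (rule prob_spaceI)
  moreover have "absolutely_continuous \<nu> \<mu>\<^sub>1" "absolutely_continuous \<nu> \<mu>\<^sub>2"
    using s sets by (auto simp: absolutely_continuous_def null_sets_def em f_def ennreal_divide_eq_0_iff)
  ultimately show ?thesis
    using sets by (auto simp: dominating_def space_prob_algebra)
qed

lemma hellinger_wrt_mono:
  assumes P: "\<nu> \<in> space (prob_algebra \<Theta>)" "\<kappa> \<in> space (prob_algebra \<Theta>)"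
      "\<mu>\<^sub>1 \<in> space (prob_algebra \<Theta>)" "\<mu>\<^sub>2 \<in> space (prob_algebra \<Theta>)"
    and ac: "absolutely_continuous \<kappa> \<nu>" "absolutely_continuous \<nu> \<mu>\<^sub>1" "absolutely_continuous \<nu> \<mu>\<^sub>2"
  shows "hellinger_wrt \<nu> \<mu>\<^sub>1 \<mu>\<^sub>2 = hellinger_wrt \<kappa> \<mu>\<^sub>1 \<mu>\<^sub>2"
proof -
  interpret n: prob_space \<nu> using P by (simp add: space_prob_algebra)
  interpret l: prob_space \<kappa> using P by (simp add: space_prob_algebra)
  have s: "sets \<nu> = sets \<kappa>" "sets \<mu>\<^sub>1 = sets \<nu>" "sets \<mu>\<^sub>2 = sets \<nu>"
    using P by (simp_all add: space_prob_algebra)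
  define h where "h = RN_deriv \<kappa> \<nu>"
  have h[measurable]: "h \<in> borel_measurable \<kappa>" by (simp add: h_def)
  have dh: "density \<kappa> h = \<nu>"
    unfolding h_def using ac s by (intro l.density_RN_deriv) auto
  have RN[measurable]: "RN_deriv \<nu> \<mu> \<in> borel_measurable \<kappa>" for \<mu>
    using borel_measurable_RN_deriv[of \<nu> \<mu>] s by (simp cong: measurable_cong_sets)
  have chain: "AE x in \<kappa>. h x * RN_deriv \<nu> \<mu> x = RN_deriv \<kappa> \<mu> x"
    if "absolutely_continuous \<nu> \<mu>" "sets \<mu> = sets \<nu>" for \<mu>
  proof (rule l.RN_deriv_unique)
    show "density \<kappa> (\<lambda>x. h x * RN_deriv \<nu> \<mu> x) = \<mu>"
      using n.density_RN_deriv[OF that] by (simp add: density_density_eq[symmetric] dh)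
  qed simp
  have "(LINT x|\<nu>. (sqrt (enn2real (RN_deriv \<nu> \<mu>\<^sub>1 x)) - sqrt (enn2real (RN_deriv \<nu> \<mu>\<^sub>2 x)))\<^sup>2)
      = (LINT x|\<kappa>. enn2real (h x) *
          (sqrt (enn2real (RN_deriv \<nu> \<mu>\<^sub>1 x)) - sqrt (enn2real (RN_deriv \<nu> \<mu>\<^sub>2 x)))\<^sup>2)"
    unfolding h_def using ac s
    by (intro l.RN_deriv_integral) (auto intro: n.sigma_finite_measure_axioms)
  also have "\<dots> = (LINT x|\<kappa>.
          (sqrt (enn2real (RN_deriv \<kappa> \<mu>\<^sub>1 x)) - sqrt (enn2real (RN_deriv \<kappa> \<mu>\<^sub>2 x)))\<^sup>2)"
  proof (rule integral_cong_AE)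
    show "AE x in \<kappa>. enn2real (h x) *
          (sqrt (enn2real (RN_deriv \<nu> \<mu>\<^sub>1 x)) - sqrt (enn2real (RN_deriv \<nu> \<mu>\<^sub>2 x)))\<^sup>2
        = (sqrt (enn2real (RN_deriv \<kappa> \<mu>\<^sub>1 x)) - sqrt (enn2real (RN_deriv \<kappa> \<mu>\<^sub>2 x)))\<^sup>2"
      using chain[OF ac(2) s(2)] chain[OF ac(3) s(3)]
    proof eventually_elim
      case (elim x)
      show ?case
        unfolding elim[symmetric]
        by (simp add: enn2real_mult real_sqrt_mult right_diff_distrib[symmetric] power_mult_distrib)
    qed
  qed measurable
  finally show ?thesis by (simp add: hellinger_wrt_def)
qed

lemma hellinger_eq_hellinger_wrt:
  assumes P: "\<mu>\<^sub>1 \<in> space (prob_algebra \<Theta>)" "\<mu>\<^sub>2 \<in> space (prob_algebra \<Theta>)"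
    and \<nu>: "\<nu> \<in> space (prob_algebra \<Theta>)" "absolutely_continuous \<nu> \<mu>\<^sub>1" "absolutely_continuous \<nu> \<mu>\<^sub>2"
  shows "hellinger \<mu>\<^sub>1 \<mu>\<^sub>2 = hellinger_wrt \<nu> \<mu>\<^sub>1 \<mu>\<^sub>2"
proof -
  define \<nu>' where "\<nu>' = (SOME \<nu>. dominating \<nu> \<mu>\<^sub>1 \<mu>\<^sub>2)"
  have "dominating \<nu>' \<mu>\<^sub>1 \<mu>\<^sub>2"
    unfolding \<nu>'_def by (rule someI_ex) (rule dominating_exists[OF P])
  then have \<nu>': "\<nu>' \<in> space (prob_algebra \<Theta>)" "absolutely_continuous \<nu>' \<mu>\<^sub>1"
      "absolutely_continuous \<nu>' \<mu>\<^sub>2"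
    using P by (auto simp: dominating_def space_prob_algebra)
  obtain \<kappa> where "dominating \<kappa> \<nu> \<nu>'"
    using dominating_exists[OF \<nu>(1) \<nu>'(1)] by auto
  then have l: "\<kappa> \<in> space (prob_algebra \<Theta>)" "absolutely_continuous \<kappa> \<nu>"
      "absolutely_continuous \<kappa> \<nu>'"
    using \<nu>(1) by (auto simp: dominating_def space_prob_algebra)
  have "hellinger_wrt \<nu>' \<mu>\<^sub>1 \<mu>\<^sub>2 = hellinger_wrt \<kappa> \<mu>\<^sub>1 \<mu>\<^sub>2"
    by (rule hellinger_wrt_mono[OF \<nu>'(1) l(1) P l(3) \<nu>'(2,3)])
  also have "\<dots> = hellinger_wrt \<nu> \<mu>\<^sub>1 \<mu>\<^sub>2"
    by (rule hellinger_wrt_mono[OF \<nu>(1) l(1) P l(2) \<nu>(2,3), symmetric])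
  finally show ?thesis by (simp add: hellinger_def \<nu>'_def)
qed

end

theory Submission
  imports Defs
begin

text \<open>
  Put \<open>a\<^sub>i = - \<Phi>\<^sub>i / 2 - ln Z\<^sub>i / 2\<close>. The density of the \<open>i\<close>-th reweighted measure is \<open>exp a\<^sub>i ^ 2\<close>,
  and the function inside the \<open>L\<^sup>2\<close> norm is \<open>- 2 (a\<^sub>1 - a\<^sub>2)\<close>. Both bounds are integrals of the pointwise
  mean value estimate \<open>min (exp a) (exp b) \<bar>a - b\<bar> \<le> \<bar>exp a - exp b\<bar> \<le> max (exp a) (exp b) \<bar>a - b\<bar>\<close>,
  which is strict unless \<open>a = b\<close>. Hence equality holds iff \<open>a\<^sub>1 = a\<^sub>2\<close> almost surely, which,
  by the choice of the normalization, is the same as \<open>\<Phi>\<^sub>1 - \<Phi>\<^sub>2\<close> being almost surely constant.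
\<close>

section \<open>Pointwise exponential estimates and equality of integrals\<close>

lemma exp_diff_strict_bounds:
  fixes a b :: real
  assumes "a < b"
  shows "exp a * (b - a) < exp b - exp a" and "exp b - exp a < exp b * (b - a)"
proof -
  obtain z where z: "a < z" "z < b" "exp b - exp a = (b - a) * exp z"
    using MVT2[OF assms, of exp exp] by (auto intro: DERIV_exp)
  show "exp a * (b - a) < exp b - exp a" "exp b - exp a < exp b * (b - a)"
    using z assms by (simp_all add: mult.commute)
qed

text \<open>A bound \<open>C\<close> stands in for the maximum of the two exponentials: unlike the
  maximum, it can be chosen independently of the point and so be taken out of an integral.\<close>

lemma abs_exp_diff_less:
  fixes a b C :: real
  assumes "a \<noteq> b" "exp a \<le> C" "exp b \<le> C"
  shows "\<bar>exp a - exp b\<bar> < C * \<bar>a - b\<bar>"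
  using assms
proof (induction a b rule: linorder_wlog)
  case (le a b)
  then have "exp b - exp a < exp b * (b - a)" by (intro exp_diff_strict_bounds) auto
  also have "\<dots> \<le> C * (b - a)" using le by (intro mult_right_mono) auto
  finally show ?case using le by simp
qed (simp add: abs_minus_commute)

lemma abs_exp_diff_greater:
  fixes a b C :: real
  assumes "a \<noteq> b" "C \<le> exp a" "C \<le> exp b"
  shows "C * \<bar>a - b\<bar> < \<bar>exp a - exp b\<bar>"
  using assms
proof (induction a b rule: linorder_wlog)
  case (le a b)
  then have "C * (b - a) \<le> exp a * (b - a)" by (intro mult_right_mono) auto
  also have "\<dots> < exp b - exp a" using le by (intro exp_diff_strict_bounds) auto
  finally show ?case using le by simp
qed (simp add: abs_minus_commute)

text \<open>Equal integrals mean that \<open>g x - f x\<close>, which is nonnegative almost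
  everywhere, integrates to 0 and therefore vanishes almost everywhere. \<open>P\<close> describes
  where the integrands agree; below it is \<open>a x = b x\<close>.\<close>

lemma sqrt_integral_mono_eq_iff:
  fixes f g :: "'a \<Rightarrow> real"
  assumes "integrable M f" "integrable M g"
    and le: "AE x in M. f x \<le> g x" and eq: "AE x in M. f x = g x \<longleftrightarrow> P x"
  shows "sqrt (LINT x|M. f x) \<le> sqrt (LINT x|M. g x)"
    and "sqrt (LINT x|M. f x) = sqrt (LINT x|M. g x) \<longleftrightarrow> (AE x in M. P x)"
proof -
  show "sqrt (LINT x|M. f x) \<le> sqrt (LINT x|M. g x)"
    using assms by (intro real_sqrt_le_mono integral_mono_AE)
  have "sqrt (LINT x|M. f x) = sqrt (LINT x|M. g x) \<longleftrightarrow> (LINT x|M. g x - f x) = 0"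
    using assms by auto
  also have "\<dots> \<longleftrightarrow> (AE x in M. g x - f x = 0)"
    using assms by (intro integral_nonneg_eq_0_iff_AE) auto
  also have "\<dots> \<longleftrightarrow> (AE x in M. P x)"
    using eq by (auto elim!: eventually_elim2)
  finally show "sqrt (LINT x|M. f x) = sqrt (LINT x|M. g x) \<longleftrightarrow> (AE x in M. P x)" .
qed

section \<open>Lebesgue norms and essential bounds\<close>

lemma nn_integral_powr_2:
  "(\<integral>\<^sup>+x. ennreal (\<bar>f x\<bar> powr enn2real 2) \<partial>M) = (\<integral>\<^sup>+x. ennreal ((f x)\<^sup>2) \<partial>M)"
proof -
  have "\<bar>f x\<bar> powr enn2real 2 = (f x)\<^sup>2" for x
    by (simp add: enn2real_numeral)
  then show ?thesis by simp
qed

lemma integrable_power2_Lp_space: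
  assumes "f \<in> Lp_space 2 M I"
  shows "integrable M (\<lambda>x. (f x)\<^sup>2)"
  using assms unfolding Lp_space_def eLp_norm_def nn_integral_powr_2
  by (auto intro!: integrableI_nonneg split: if_splits)

lemma Lp_norm_2_eq_sqrt_integral:
  assumes "integrable M (\<lambda>x. (f x)\<^sup>2)"
  shows "Lp_norm 2 M f = sqrt (LINT x|M. (f x)\<^sup>2)"
proof -
  have "(\<integral>\<^sup>+x. ennreal ((f x)\<^sup>2) \<partial>M) = ennreal (LINT x|M. (f x)\<^sup>2)"
    using assms by (intro nn_integral_eq_integral) auto
  then show ?thesis
    unfolding Lp_norm_def eLp_norm_def nn_integral_powr_2
    by (simp add: enn2real_numeral powr_half_sqrt)
qed

lemma AE_abs_le_Lp_norm_infinity: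
  assumes "f \<in> Lp_space \<infinity> M I"
  shows "AE x in M. \<bar>f x\<bar> \<le> Lp_norm \<infinity> M f"
proof -
  have fin: "esssup M (\<lambda>x. ereal \<bar>f x\<bar>) < \<infinity>" and [measurable]: "f \<in> borel_measurable M"
    using assms by (auto simp: Lp_space_def eLp_norm_def)
  have "AE x in M. ereal \<bar>f x\<bar> \<le> esssup M (\<lambda>x. ereal \<bar>f x\<bar>)"
    by (rule esssup_AE)
  then show ?thesis
  proof eventually_elim
    case (elim x)
    then show ?case
      \<comment> \<open>Only a finite essential supremum survives \<open>real_of_ereal\<close>
        unchanged. The value \<infinity> is excluded by \<open>fin\<close>, and -\<infinity> cannot
        bound an absolute value from above.\<close>
      using fin by (cases "esssup M (\<lambda>x. ereal \<bar>f x\<bar>)") (auto simp: Lp_norm_def eLp_norm_def)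
  qed
qed

text \<open>Unfolding the supremum only yields almost sure lower bounds below 0. Taking -1/(n+1) for
  every n leaves countably many null sets, whose union is null.\<close>

lemma AE_nonneg_essinf:
  assumes "0 \<le> essinf M f"
  shows "AE x in M. 0 \<le> f x"
proof -
  have "AE x in M. - 1 / real (Suc n) \<le> f x" for n
  proof -
    have "ereal (- 1 / real (Suc n)) < 0" by simp
    then have "ereal (- 1 / real (Suc n)) < essinf M f" using assms by (rule less_le_trans)
    then obtain z where z: "ereal (- 1 / real (Suc n)) < z" "AE x in M. z \<le> ereal (f x)"
      unfolding essinf_def less_Sup_iff by auto
    from z(2) show ?thesis
    proof eventually_elim
      case (elim x)
      with z(1) have "ereal (- 1 / real (Suc n)) < ereal (f x)" by (rule less_le_trans)
      then show ?case by simp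
    qed
  qed
  then have "AE x in M. \<forall>n. - 1 / real (Suc n) \<le> f x" by (simp add: AE_all_countable)
  then show ?thesis
  proof eventually_elim
    case (elim x)
    show ?case
    proof (rule ccontr)
      assume "\<not> 0 \<le> f x"
      then obtain n where "inverse (real (Suc n)) < - f x" using reals_Archimedean[of "- f x"] by auto
      then show False using elim[rule_format, of n] by (simp add: field_simps)
    qed
  qed
qed

text \<open>\<open>M\<close> itself dominates both reweighted measures, so it may serve as the
  reference measure; the derivatives are then the defining densities, whose square roots are again
  exponentials.\<close>

lemma (in prob_space) hellinger_reweighted:
  assumes [measurable]: "f \<in> borel_measurable M" "g \<in> borel_measurable M"
    and Zf: "normalization_const M f = ennreal Z\<^sub>f" "0 < Z\<^sub>f"
    and Zg: "normalization_const M g = ennreal Z\<^sub>g" "0 < Z\<^sub>g"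
  shows "hellinger (reweighted M f) (reweighted M g) =
    sqrt (LINT x|M. (exp (- f x / 2 - ln Z\<^sub>f / 2) - exp (- g x / 2 - ln Z\<^sub>g / 2))\<^sup>2)"
proof -
  have M: "M \<in> space (prob_algebra M)"
    by (simp add: space_prob_algebra prob_space_axioms)
  have P: "reweighted M f \<in> space (prob_algebra M)" "reweighted M g \<in> space (prob_algebra M)"
    using Zf Zg by (simp_all add: reweighted_in_prob_algebra_iff[OF M])
  have ac: "absolutely_continuous M (reweighted M h)" if [measurable]: "h \<in> borel_measurable M" for h
    unfolding reweighted_def by (intro absolutely_continuousI_density) simp
  have RN: "AE x in M. sqrt (enn2real (RN_deriv M (reweighted M h) x)) = exp (- h x / 2 - ln Z / 2)"
    if [measurable]: "h \<in> borel_measurable M" and Z: "normalization_const M h = ennreal Z" "0 < Z" for h Z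
  proof -
    have "AE x in M. ennreal (exp (- h x)) / normalization_const M h = RN_deriv M (reweighted M h) x"
      by (rule RN_deriv_unique) (simp_all add: reweighted_def)
    then show ?thesis
    proof eventually_elim
      case (elim x)
      have "(exp (- h x / 2 - ln Z / 2))\<^sup>2 = exp (- h x - ln Z)"
        by (simp add: exp_double[symmetric])
      also have "\<dots> = exp (- h x) / Z"
        using Z(2) by (simp add: exp_diff)
      finally have "(exp (- h x / 2 - ln Z / 2))\<^sup>2 = exp (- h x) / Z" .
      moreover have "enn2real (RN_deriv M (reweighted M h) x) = exp (- h x) / Z"
        using Z by (simp add: elim[symmetric] divide_ennreal)
      ultimately show ?case by (simp add: real_sqrt_unique)
    qed
  qed
  have "hellinger (reweighted M f) (reweighted M g) = hellinger_wrt M (reweighted M f) (reweighted M g)"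
    using P M ac by (intro hellinger_eq_hellinger_wrt) auto
  also have "\<dots> = sqrt (LINT x|M. (exp (- f x / 2 - ln Z\<^sub>f / 2) - exp (- g x / 2 - ln Z\<^sub>g / 2))\<^sup>2)"
    unfolding hellinger_wrt_def
  proof (intro arg_cong[where f = sqrt] integral_cong_AE)
    show "AE x in M. (sqrt (enn2real (RN_deriv M (reweighted M f) x))
          - sqrt (enn2real (RN_deriv M (reweighted M g) x)))\<^sup>2
        = (exp (- f x / 2 - ln Z\<^sub>f / 2) - exp (- g x / 2 - ln Z\<^sub>g / 2))\<^sup>2"
      using RN[OF assms(1) Zf] RN[OF assms(2) Zg] by eventually_elim simp
  qed measurable
  finally show ?thesis .
qed

theorem proposition4p1:
  fixes \<Theta> \<mu> :: "'a measure" and \<Phi>\<^sub>1 \<Phi>\<^sub>2 :: "'a \<Rightarrow> real"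
  assumes "\<mu> \<in> space (prob_algebra \<Theta>)"
    and "\<Phi>\<^sub>1 \<in> Lp_space 2 \<mu> UNIV" and "\<Phi>\<^sub>2 \<in> Lp_space 2 \<mu> UNIV"
    and "0 < normalization_const \<mu> \<Phi>\<^sub>1" and "normalization_const \<mu> \<Phi>\<^sub>1 < \<infinity>"
    and "0 < normalization_const \<mu> \<Phi>\<^sub>2" and "normalization_const \<mu> \<Phi>\<^sub>2 < \<infinity>"
  shows
    "(let Z\<^sub>1 = enn2real (normalization_const \<mu> \<Phi>\<^sub>1);
          Z\<^sub>2 = enn2real (normalization_const \<mu> \<Phi>\<^sub>2);
          d = hellinger (reweighted \<mu> \<Phi>\<^sub>1) (reweighted \<mu> \<Phi>\<^sub>2);
          N = Lp_norm 2 \<mu> (\<lambda>x. \<Phi>\<^sub>1 x - \<Phi>\<^sub>2 x + ln (Z\<^sub>1 / Z\<^sub>2));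
          upper = 1 / 2 * (1 / min (sqrt Z\<^sub>1) (sqrt Z\<^sub>2)) * N;
          lower = 1 / 2 * min (exp (- (1 / 2) * Lp_norm \<infinity> \<mu> \<Phi>\<^sub>1) / sqrt Z\<^sub>1)
                              (exp (- (1 / 2) * Lp_norm \<infinity> \<mu> \<Phi>\<^sub>2) / sqrt Z\<^sub>2) * N;
          diff_const = (\<exists>c. AE x in \<mu>. \<Phi>\<^sub>1 x - \<Phi>\<^sub>2 x = c)
      in (essinf \<mu> \<Phi>\<^sub>1 \<ge> 0 \<and> essinf \<mu> \<Phi>\<^sub>2 \<ge> 0
            \<longrightarrow> d \<le> upper \<and> (d = upper \<longleftrightarrow> diff_const)) \<and>
         (\<Phi>\<^sub>1 \<in> Lp_space \<infinity> \<mu> {0..} \<and> \<Phi>\<^sub>2 \<in> Lp_space \<infinity> \<mu> {0..}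
            \<longrightarrow> d \<ge> lower \<and> (d = lower \<longleftrightarrow> diff_const)))"
proof -
  interpret prob_space \<mu> using assms(1) by (simp add: space_prob_algebra)
  have [measurable]: "\<Phi>\<^sub>1 \<in> borel_measurable \<mu>" "\<Phi>\<^sub>2 \<in> borel_measurable \<mu>"
    using assms(2,3) by (auto simp: Lp_space_def)
  define Z\<^sub>1 where "Z\<^sub>1 = enn2real (normalization_const \<mu> \<Phi>\<^sub>1)"
  define Z\<^sub>2 where "Z\<^sub>2 = enn2real (normalization_const \<mu> \<Phi>\<^sub>2)"
  have Z\<^sub>1: "normalization_const \<mu> \<Phi>\<^sub>1 = ennreal Z\<^sub>1" "0 < Z\<^sub>1"
    and Z\<^sub>2: "normalization_const \<mu> \<Phi>\<^sub>2 = ennreal Z\<^sub>2" "0 < Z\<^sub>2"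
    using assms(4-7) by (auto simp: Z\<^sub>1_def Z\<^sub>2_def enn2real_positive_iff)
  define a where "a x = - \<Phi>\<^sub>1 x / 2 - ln Z\<^sub>1 / 2" for x
  define b where "b x = - \<Phi>\<^sub>2 x / 2 - ln Z\<^sub>2 / 2" for x
  have [measurable]: "a \<in> borel_measurable \<mu>" "b \<in> borel_measurable \<mu>"
    by (simp_all add: a_def[abs_def] b_def[abs_def])
  have exp_a: "exp (a x) = exp (- \<Phi>\<^sub>1 x / 2) / sqrt Z\<^sub>1"
    and exp_b: "exp (b x) = exp (- \<Phi>\<^sub>2 x / 2) / sqrt Z\<^sub>2" for x
    using Z\<^sub>1(2) Z\<^sub>2(2) by (simp_all add: a_def b_def exp_diff ln_sqrt[symmetric])
  have log_diff: "\<Phi>\<^sub>1 x - \<Phi>\<^sub>2 x + ln (Z\<^sub>1 / Z\<^sub>2) = - 2 * (a x - b x)" for x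
    using Z\<^sub>1(2) Z\<^sub>2(2) by (simp add: a_def b_def ln_div)

  have int_S: "integrable \<mu> (\<lambda>x. (a x - b x)\<^sup>2)"
  proof -
    have sq: "integrable \<mu> (\<lambda>x. (\<Phi>\<^sub>1 x)\<^sup>2)" "integrable \<mu> (\<lambda>x. (\<Phi>\<^sub>2 x)\<^sup>2)"
      using assms(2,3) by (auto intro: integrable_power2_Lp_space)
    let ?c = "ln (Z\<^sub>1 / Z\<^sub>2)"
    \<comment> \<open>The constant term is integrable because \<open>\<mu>\<close> is
      finite.\<close>
    have "integrable \<mu> (\<lambda>x. (\<Phi>\<^sub>1 x)\<^sup>2 + (\<Phi>\<^sub>2 x)\<^sup>2 + ?c\<^sup>2)" using sq by simp
    then show ?thesis
    proof (rule Bochner_Integration.integrable_bound)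
      have "(a x - b x)\<^sup>2 \<le> (\<Phi>\<^sub>1 x)\<^sup>2 + (\<Phi>\<^sub>2 x)\<^sup>2 + ?c\<^sup>2" for x
      proof -
        have "4 * (a x - b x)\<^sup>2 = (\<Phi>\<^sub>1 x - \<Phi>\<^sub>2 x + ?c)\<^sup>2"
          unfolding log_diff by (simp add: power2_eq_square algebra_simps)
        \<comment> \<open>The right side minus the left side is exactly the sum of the three squares
          supplied below.\<close>
        also have "\<dots> \<le> 3 * ((\<Phi>\<^sub>1 x)\<^sup>2 + (\<Phi>\<^sub>2 x)\<^sup>2 + ?c\<^sup>2)"
          using zero_le_power2[of "\<Phi>\<^sub>1 x + \<Phi>\<^sub>2 x"] zero_le_power2[of "\<Phi>\<^sub>1 x - ?c"]
            zero_le_power2[of "\<Phi>\<^sub>2 x + ?c"]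
          by (simp add: power2_eq_square algebra_simps)
        \<comment> \<open>Weakening 3 to 4 lets the factor cancel against the one on the
          left.\<close>
        also have "\<dots> \<le> 4 * ((\<Phi>\<^sub>1 x)\<^sup>2 + (\<Phi>\<^sub>2 x)\<^sup>2 + ?c\<^sup>2)"
          by (intro mult_right_mono) auto
        finally show ?thesis by simp
      qed
      then show "AE x in \<mu>. norm ((a x - b x)\<^sup>2) \<le> norm ((\<Phi>\<^sub>1 x)\<^sup>2 + (\<Phi>\<^sub>2 x)\<^sup>2 + ?c\<^sup>2)"
        by simp
    qed measurable
  qed
  have int_D: "integrable \<mu> (\<lambda>x. (exp (a x) - exp (b x))\<^sup>2)"
  proof -
    have "integrable \<mu> (\<lambda>x. exp (- \<Phi>\<^sub>1 x))" "integrable \<mu> (\<lambda>x. exp (- \<Phi>\<^sub>2 x))"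
      using assms(5,7) by (auto intro!: integrableI_nonneg simp: normalization_const_def)
    then have "integrable \<mu> (\<lambda>x. exp (- \<Phi>\<^sub>1 x) / Z\<^sub>1 + exp (- \<Phi>\<^sub>2 x) / Z\<^sub>2)" by simp
    then show ?thesis
    proof (rule Bochner_Integration.integrable_bound)
      have "(exp (a x) - exp (b x))\<^sup>2 \<le> exp (- \<Phi>\<^sub>1 x) / Z\<^sub>1 + exp (- \<Phi>\<^sub>2 x) / Z\<^sub>2" for x
      proof -
        \<comment> \<open>The discarded cross term \<open>- 2 * exp (a x) * exp (b x)\<close> is
          negative.\<close>
        have "(exp (a x) - exp (b x))\<^sup>2 \<le> (exp (a x))\<^sup>2 + (exp (b x))\<^sup>2"
          by (simp add: power2_diff)
        also have "\<dots> = exp (- \<Phi>\<^sub>1 x) / Z\<^sub>1 + exp (- \<Phi>\<^sub>2 x) / Z\<^sub>2"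
          using Z\<^sub>1(2) Z\<^sub>2(2) by (simp add: exp_a exp_b power_divide exp_double[symmetric])
        finally show ?thesis .
      qed
      then show "AE x in \<mu>. norm ((exp (a x) - exp (b x))\<^sup>2)
          \<le> norm (exp (- \<Phi>\<^sub>1 x) / Z\<^sub>1 + exp (- \<Phi>\<^sub>2 x) / Z\<^sub>2)"
        using Z\<^sub>1(2) Z\<^sub>2(2) by simp
    qed measurable
  qed

  define d where "d = hellinger (reweighted \<mu> \<Phi>\<^sub>1) (reweighted \<mu> \<Phi>\<^sub>2)"
  define N where "N = Lp_norm 2 \<mu> (\<lambda>x. \<Phi>\<^sub>1 x - \<Phi>\<^sub>2 x + ln (Z\<^sub>1 / Z\<^sub>2))"
  have d: "d = sqrt (LINT x|\<mu>. (exp (a x) - exp (b x))\<^sup>2)"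
    unfolding d_def a_def b_def using Z\<^sub>1 Z\<^sub>2 by (intro hellinger_reweighted) measurable
  \<comment> \<open>The factor 1/2 of both bounds cancels the 2 in \<open>log_diff\<close>. With
    \<open>C\<close> inside the square, both bounds become comparisons of integrands.\<close>
  have N: "1 / 2 * C * N = sqrt (LINT x|\<mu>. (C * \<bar>a x - b x\<bar>)\<^sup>2)" if "0 \<le> C" for C
  proof -
    have sq: "(- 2 * (a x - b x))\<^sup>2 = 4 * (a x - b x)\<^sup>2" for x
      by (simp add: power2_eq_square algebra_simps)
    have "N = sqrt (LINT x|\<mu>. (- 2 * (a x - b x))\<^sup>2)"
      unfolding N_def log_diff
      by (intro Lp_norm_2_eq_sqrt_integral) (simp only: sq, simp add: int_S)
    also have "\<dots> = 2 * sqrt (LINT x|\<mu>. (a x - b x)\<^sup>2)"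
      unfolding sq by (simp add: real_sqrt_mult)
    finally show ?thesis using that by (simp add: power_mult_distrib real_sqrt_mult)
  qed

  have diff_const: "(AE x in \<mu>. a x = b x) \<longleftrightarrow> (\<exists>c. AE x in \<mu>. \<Phi>\<^sub>1 x - \<Phi>\<^sub>2 x = c)"
  proof
    assume "AE x in \<mu>. a x = b x"
    then have "AE x in \<mu>. \<Phi>\<^sub>1 x - \<Phi>\<^sub>2 x = - ln (Z\<^sub>1 / Z\<^sub>2)"
    proof eventually_elim
      case (elim x)
      then show ?case using log_diff[of x] by simp
    qed
    then show "\<exists>c. AE x in \<mu>. \<Phi>\<^sub>1 x - \<Phi>\<^sub>2 x = c" ..
  next
    assume "\<exists>c. AE x in \<mu>. \<Phi>\<^sub>1 x - \<Phi>\<^sub>2 x = c"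
    then obtain c where c: "AE x in \<mu>. \<Phi>\<^sub>1 x - \<Phi>\<^sub>2 x = c" ..
    \<comment> \<open>Normalization determines the constant: a shift of the potential by
      \<open>c\<close> scales its normalization constant by \<open>exp (- c)\<close>, so the
      logarithmic term is \<open>- c\<close> and cancels the shift.\<close>
    have "ennreal Z\<^sub>1 = (\<integral>\<^sup>+x. ennreal (exp (- c)) * ennreal (exp (- \<Phi>\<^sub>2 x)) \<partial>\<mu>)"
      unfolding Z\<^sub>1(1)[symmetric] normalization_const_def
    proof (rule nn_integral_cong_AE)
      show "AE x in \<mu>. ennreal (exp (- \<Phi>\<^sub>1 x)) = ennreal (exp (- c)) * ennreal (exp (- \<Phi>\<^sub>2 x))"
        using c by eventually_elim (auto simp: ennreal_mult[symmetric] exp_add[symmetric])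
    qed
    also have "\<dots> = ennreal (exp (- c) * Z\<^sub>2)"
      using Z\<^sub>2 by (simp add: nn_integral_cmult normalization_const_def ennreal_mult)
    finally have "Z\<^sub>1 = exp (- c) * Z\<^sub>2" using Z\<^sub>1(2) Z\<^sub>2(2) by simp
    then have ln: "ln (Z\<^sub>1 / Z\<^sub>2) = - c" using Z\<^sub>2(2) by simp
    from c show "AE x in \<mu>. a x = b x"
    proof eventually_elim
      case (elim x)
      then show ?case using log_diff[of x] ln by simp
    qed
  qed

  \<comment> \<open>Where \<open>a x = b x\<close> both integrands are 0, and elsewhere the estimate
    is strict. The equality case is therefore the same for every admissible \<open>C\<close>, and
    likewise for \<open>lower\<close>.\<close>
  have upper: "d \<le> 1 / 2 * C * N" "d = 1 / 2 * C * N \<longleftrightarrow> (AE x in \<mu>. a x = b x)"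
    if C: "0 \<le> C" and bound: "AE x in \<mu>. exp (a x) \<le> C \<and> exp (b x) \<le> C" for C
  proof -
    have pw: "AE x in \<mu>. (exp (a x) - exp (b x))\<^sup>2 \<le> (C * \<bar>a x - b x\<bar>)\<^sup>2 \<and>
        ((exp (a x) - exp (b x))\<^sup>2 = (C * \<bar>a x - b x\<bar>)\<^sup>2 \<longleftrightarrow> a x = b x)"
      using bound
    proof eventually_elim
      case (elim x)
      show ?case
      proof (cases "a x = b x")
        case False
        then have "\<bar>exp (a x) - exp (b x)\<bar>\<^sup>2 < (C * \<bar>a x - b x\<bar>)\<^sup>2"
          using elim by (intro power_strict_mono abs_exp_diff_less) auto
        then show ?thesis using False by simp
      qed simp
    qed
    have int: "integrable \<mu> (\<lambda>x. (C * \<bar>a x - b x\<bar>)\<^sup>2)"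
      using int_S by (simp add: power_mult_distrib)
    show "d \<le> 1 / 2 * C * N" "d = 1 / 2 * C * N \<longleftrightarrow> (AE x in \<mu>. a x = b x)"
      unfolding d N[OF C] using pw
      by (intro sqrt_integral_mono_eq_iff int_D int; auto elim: eventually_mono)+
  qed
  have lower: "1 / 2 * C * N \<le> d" "d = 1 / 2 * C * N \<longleftrightarrow> (AE x in \<mu>. a x = b x)"
    if C: "0 \<le> C" and bound: "AE x in \<mu>. C \<le> exp (a x) \<and> C \<le> exp (b x)" for C
  proof -
    have pw: "AE x in \<mu>. (C * \<bar>a x - b x\<bar>)\<^sup>2 \<le> (exp (a x) - exp (b x))\<^sup>2 \<and>
        ((C * \<bar>a x - b x\<bar>)\<^sup>2 = (exp (a x) - exp (b x))\<^sup>2 \<longleftrightarrow> a x = b x)"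
      using bound
    proof eventually_elim
      case (elim x)
      show ?case
      proof (cases "a x = b x")
        case False
        \<comment> \<open>Here \<open>0 \<le> C\<close> is what makes the smaller base nonnegative,
          so that squaring preserves the strict inequality.\<close>
        then have "(C * \<bar>a x - b x\<bar>)\<^sup>2 < \<bar>exp (a x) - exp (b x)\<bar>\<^sup>2"
          using elim C by (intro power_strict_mono abs_exp_diff_greater) auto
        then show ?thesis using False by simp
      qed simp
    qed
    have int: "integrable \<mu> (\<lambda>x. (C * \<bar>a x - b x\<bar>)\<^sup>2)"
      using int_S by (simp add: power_mult_distrib)
    show "1 / 2 * C * N \<le> d" "d = 1 / 2 * C * N \<longleftrightarrow> (AE x in \<mu>. a x = b x)"
      \<comment> \<open>The equation is turned round because
        \<open>sqrt_integral_mono_eq_iff\<close> has the smaller integrand on its left.\<close>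
      unfolding d N[OF C] eq_commute[of "sqrt (LINT x|\<mu>. (exp (a x) - exp (b x))\<^sup>2)"] using pw
      by (intro sqrt_integral_mono_eq_iff int_D int; auto elim: eventually_mono)+
  qed

  let ?U = "1 / min (sqrt Z\<^sub>1) (sqrt Z\<^sub>2)"
  let ?L = "min (exp (- (1 / 2) * Lp_norm \<infinity> \<mu> \<Phi>\<^sub>1) / sqrt Z\<^sub>1)
                (exp (- (1 / 2) * Lp_norm \<infinity> \<mu> \<Phi>\<^sub>2) / sqrt Z\<^sub>2)"
  \<comment> \<open>For nonnegative potentials the numerators in \<open>exp_a\<close> and
    \<open>exp_b\<close> are at most 1, and the smaller denominator bounds both quotients.\<close>
  have U_bound: "AE x in \<mu>. exp (a x) \<le> ?U \<and> exp (b x) \<le> ?U"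
    if "0 \<le> essinf \<mu> \<Phi>\<^sub>1" "0 \<le> essinf \<mu> \<Phi>\<^sub>2"
    using AE_nonneg_essinf[OF that(1)] AE_nonneg_essinf[OF that(2)]
  proof eventually_elim
    case (elim x)
    then show ?case
      using Z\<^sub>1(2) Z\<^sub>2(2) unfolding exp_a exp_b by (intro conjI frac_le) auto
  qed
  \<comment> \<open>Almost surely each potential is at most its essential supremum norm, so each
    entry of the minimum bounds its own exponential from below.\<close>
  have L_bound: "AE x in \<mu>. ?L \<le> exp (a x) \<and> ?L \<le> exp (b x)"
    if "\<Phi>\<^sub>1 \<in> Lp_space \<infinity> \<mu> {0..}" "\<Phi>\<^sub>2 \<in> Lp_space \<infinity> \<mu> {0..}"
    using AE_abs_le_Lp_norm_infinity[OF that(1)] AE_abs_le_Lp_norm_infinity[OF that(2)]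
  proof eventually_elim
    case (elim x)
    then show ?case
      using Z\<^sub>1(2) Z\<^sub>2(2) unfolding exp_a exp_b
      by (intro conjI min.coboundedI1 min.coboundedI2 divide_right_mono) auto
  qed
  have "0 \<le> ?U" "0 \<le> ?L" using Z\<^sub>1(2) Z\<^sub>2(2) by auto
  then show ?thesis
    unfolding Let_def Z\<^sub>1_def[symmetric] Z\<^sub>2_def[symmetric] d_def[symmetric] N_def[symmetric]
      diff_const[symmetric]
    using upper[of ?U] lower[of ?L] U_bound L_bound by blast
qed

end
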